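(* Let $n \geq 7$ be odd, and let $\omega_n := (1, 3, \ldots, n, n-1, n-3, \ldots, 2)$ be the cyclic order on $\{1,\ldots,n\}$ listing the odd numbers increasingly and then the even numbers decreasingly. Then $C(n,\{1,2,3\})$ is nearly dispersable with respect to $\omega_n$.
   Context: All graphs are finite and simple. For a set $S=\{i_1<\cdots<i_k\}$ of integers with $k\ge 1$, $1\le i_1$ and $i_k\le \lfloor n/2\rfloor$, the circulant $C(n,S)$ is the graph on vertex set $\{1,\ldots,n\}$ in which each $j$ is adjacent to $j+i_r$ (addition mod $n$) for $r=1,\ldots,k$. Given a graph $G$ and a cyclic order $\omega$ on $V(G)$, draw the vertices on a circle in the order $\omega$ and the edges as straight chords; two edges cross if they intersect at a point that is not an endpoint. A matching book embedding $(G,\omega,c)$ consists of $G$, a cyclic order $\omega$, and an edge-coloring $c$ (the color classes are the pages) such that any two distinct edges of the same color neither cross nor share an endpoint. The embedding is dispersable if the number of colors equals the maximum degree $\Delta(G)$, and nearly dispersable if the number of colors equals $1+\Delta(G)$. A graph is dispersable if it has a dispersable matching book embedding; it is nearly dispersable if it is not dispersable and has a nearly dispersable matching book embedding. "Nearly dispersable with respect to $\omega$" means that the graph $G$ is not dispersable and has a nearly dispersable matching book embedding $(G,\omega,c)$ with this particular cyclic order $\omega$. *)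

theory Defs
  imports "HOL-Analysis.Analysis" "HOL-Number_Theory.Cong"
begin

record 'a graph =
  vertices :: "'a set"
  edges :: "'a set set"

definition simple_graph :: "'a graph \<Rightarrow> bool" where
  "simple_graph G \<longleftrightarrow>
     finite (vertices G) \<and> (\<forall>e\<in>edges G. e \<subseteq> vertices G \<and> card e = 2)"

definition degree :: "'a graph \<Rightarrow> 'a \<Rightarrow> nat" where
  "degree G v = card {e \<in> edges G. v \<in> e}"

(* The supremum of the empty set of naturals is 0, so the graph without vertices
   has maximum degree 0. *)
definition max_degree :: "'a graph \<Rightarrow> nat" where
  "max_degree G = (SUP v\<in>vertices G. degree G v)"

(* Residues modulo n are represented by 1, ..., n, so that n plays the role of 0.
   The intended use is with S a nonempty subset of {1..n div 2}. *)
definition circulant :: "nat \<Rightarrow> nat set \<Rightarrow> nat graph" where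
  "circulant n S =
     \<lparr>vertices = {1..n},
      edges = {{j, k} | j k. j \<in> {1..n} \<and> k \<in> {1..n} \<and> (\<exists>i\<in>S. [k = j + i] (mod n))}\<rparr>"

(* A cyclic order is represented by any one of the lists obtained by cutting it open;
   rotating the list does not change which edges cross. *)
definition cyclic_order :: "'a list \<Rightarrow> 'a set \<Rightarrow> bool" where
  "cyclic_order \<omega> V \<longleftrightarrow> distinct \<omega> \<and> set \<omega> = V"

(* The vertices are drawn at the corners of a regular polygon inscribed in the unit circle.
   Crossing of chords depends only on the cyclic order of their endpoints, so the choice of
   points on the circle is immaterial. *)
definition position :: "'a list \<Rightarrow> 'a \<Rightarrow> complex" where
  "position \<omega> v =
     cis (2 * pi * real (THE i. i < length \<omega> \<and> \<omega> ! i = v) / real (length \<omega>))"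

(* The convex hull of the two endpoints is the closed segment between them. *)
definition chord :: "'a list \<Rightarrow> 'a set \<Rightarrow> complex set" where
  "chord \<omega> e = convex hull (position \<omega> ` e)"

definition crosses :: "'a list \<Rightarrow> 'a set \<Rightarrow> 'a set \<Rightarrow> bool" where
  "crosses \<omega> e f \<longleftrightarrow> (\<exists>p \<in> chord \<omega> e \<inter> chord \<omega> f. p \<notin> position \<omega> ` (e \<union> f))"

definition matching_book_embedding ::
    "'a graph \<Rightarrow> 'a list \<Rightarrow> ('a set \<Rightarrow> nat) \<Rightarrow> bool" where
  "matching_book_embedding G \<omega> c \<longleftrightarrow>
     simple_graph G \<and> cyclic_order \<omega> (vertices G) \<and>
     (\<forall>e\<in>edges G. \<forall>f\<in>edges G. e \<noteq> f \<and> c e = c f \<longrightarrow> \<not> crosses \<omega> e f \<and> e \<inter> f = {})"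

definition num_pages :: "'a graph \<Rightarrow> ('a set \<Rightarrow> nat) \<Rightarrow> nat" where
  "num_pages G c = card (c ` edges G)"

definition dispersable :: "'a graph \<Rightarrow> bool" where
  "dispersable G \<longleftrightarrow>
     (\<exists>\<omega> c. matching_book_embedding G \<omega> c \<and> num_pages G c = max_degree G)"

definition nearly_dispersable_wrt :: "'a graph \<Rightarrow> 'a list \<Rightarrow> bool" where
  "nearly_dispersable_wrt G \<omega> \<longleftrightarrow>
     \<not> dispersable G \<and>
     (\<exists>c. matching_book_embedding G \<omega> c \<and> num_pages G c = 1 + max_degree G)"

definition odd_even_order :: "nat \<Rightarrow> nat list" where
  "odd_even_order n = filter odd [1..<Suc n] @ rev (filter even [1..<Suc n])"

lemma odd_even_order_9: "odd_even_order 9 = [1, 3, 5, 7, 9, 8, 6, 4, 2]"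
  by (simp add: odd_even_order_def upt_rec)

lemma cyclic_order_odd_even_order: "cyclic_order (odd_even_order n) {1..n}"
  by (auto simp: cyclic_order_def odd_even_order_def)

lemma simple_graph_circulant:
  assumes "S \<subseteq> {1..n div 2}"
  shows "simple_graph (circulant n S)"
proof -
  have False if "j \<in> {1..n}" "i \<in> S" "[j = j + i] (mod n)" for i j
  proof -
    have "1 \<le> i" "i \<le> n div 2"
      using \<open>i \<in> S\<close> assms by auto
    then have "0 < i" "i < n"
      by linarith+
    moreover have "n dvd i"
      using that(3) by (metis cong_add_lcancel_0_nat cong_0_iff cong_sym)
    ultimately show False
      using nat_dvd_not_less by blast
  qed
  then show ?thesis
    by (fastforce simp: simple_graph_def circulant_def card_2_iff)
qed

end

theory Submission
  imports Defs
begin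

text \<open>The graph is 6-regular with \<open>3 n\<close> edges, whereas a matching on an odd number \<open>n\<close> of vertices has
  at most \<open>(n - 1) / 2\<close> edges; hence six pages never suffice. Seven explicit pages do: four consist
  mostly of parallel chords, and three share the sides of the polygon and the long chords.\<close>

section \<open>Chords of a circle\<close>

text \<open>Inside the arc, the distance of \<theta> from the middle angle is less than half the arc
  length, and cosine decreases on \<open>[0, pi]\<close>. Geometrically, \<open>cis \<theta>\<close>
  lies strictly on the arc's side of the chord.\<close>

lemma cos_less_cos_inside_arc:
  fixes \<alpha> \<beta> \<theta> :: real
  assumes "\<alpha> < \<theta>" "\<theta> < \<beta>" "\<beta> - \<alpha> < 2 * pi"
  shows "cos ((\<beta> - \<alpha>) / 2) < cos (\<theta> - (\<alpha> + \<beta>) / 2)"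
proof -
  have "cos ((\<beta> - \<alpha>) / 2) < cos \<bar>\<theta> - (\<alpha> + \<beta>) / 2\<bar>"
    using assms by (intro cos_monotone_0_pi) (auto simp: abs_if field_simps)
  then show ?thesis
    by simp
qed

text \<open>With h half the arc length, the distance of \<theta> from the middle angle lies strictly
  between h and 2 pi - h. Beyond pi, reflecting x to 2 pi - x returns to the range where cosine
  decreases.\<close>

lemma cos_less_cos_outside_arc:
  fixes \<alpha> \<beta> \<theta> :: real
  assumes "\<alpha> < \<beta>" "\<theta> < \<alpha> \<or> \<beta> < \<theta>" "\<beta> - 2 * pi < \<theta>" "\<theta> < \<alpha> + 2 * pi"
  shows "cos (\<theta> - (\<alpha> + \<beta>) / 2) < cos ((\<beta> - \<alpha>) / 2)"
proof -
  define x where "x = \<bar>\<theta> - (\<alpha> + \<beta>) / 2\<bar>"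
  have x: "(\<beta> - \<alpha>) / 2 < x" "x < 2 * pi - (\<beta> - \<alpha>) / 2"
    using assms by (auto simp: x_def abs_if field_simps)
  have "cos x < cos ((\<beta> - \<alpha>) / 2)"
  proof (cases "x \<le> pi")
    case True
    then show ?thesis
      using x assms(1) by (intro cos_monotone_0_pi) auto
  next
    case False
    then have "cos (2 * pi - x) < cos ((\<beta> - \<alpha>) / 2)"
      using x assms(1) by (intro cos_monotone_0_pi) (auto simp: field_simps)
    then show ?thesis
      by (simp add: cos_diff)
  qed
  then show ?thesis
    by (simp add: x_def)
qed

lemma convex_hull_pair_subset:
  assumes "x \<in> S" "y \<in> S" "convex S"
  shows "convex hull {x, y} \<subseteq> S"
  using assms by (intro hull_minimal) auto

text \<open>The line through the endpoints of the first chord separates the two chords.\<close>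

lemma chords_disjoint:
  fixes \<alpha> \<beta> \<gamma> \<delta> :: real
  assumes "0 \<le> \<alpha>" "\<alpha> < \<beta>" "\<beta> < 2 * pi"
    and "0 \<le> \<gamma>" "\<gamma> < \<delta>" "\<delta> < 2 * pi"
    and sep: "\<alpha> < \<gamma> \<and> \<delta> < \<beta> \<or> \<beta> < \<gamma> \<or> \<delta> < \<alpha> \<or> \<gamma> < \<alpha> \<and> \<beta> < \<delta>"
  shows "convex hull {cis \<alpha>, cis \<beta>} \<inter> convex hull {cis \<gamma>, cis \<delta>} = {}"
proof -
  \<comment> \<open>\<open>u\<close> is the unit normal of the first chord, pointing to the middle
    of its arc, and \<open>r\<close> is the distance of the chord's line from the centre, with
    sign.\<close>
  define u where "u = cis ((\<alpha> + \<beta>) / 2)"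
  define r where "r = cos ((\<beta> - \<alpha>) / 2)"
  have u: "u \<bullet> cis \<theta> = cos (\<theta> - (\<alpha> + \<beta>) / 2)" for \<theta>
    by (simp add: u_def inner_complex_def cos_diff)
  have "cos (\<alpha> - (\<alpha> + \<beta>) / 2) = cos (- ((\<beta> - \<alpha>) / 2))"
    by (rule arg_cong[of _ _ cos]) (simp add: field_simps)
  then have "u \<bullet> cis \<alpha> = r"
    unfolding u r_def by simp
  moreover have "u \<bullet> cis \<beta> = r"
    unfolding u r_def by (rule arg_cong[of _ _ cos]) (simp add: field_simps)
  ultimately have e: "convex hull {cis \<alpha>, cis \<beta>} \<subseteq> {z. u \<bullet> z = r}"
    by (intro convex_hull_pair_subset convex_hyperplane) auto
  show ?thesis
  \<comment> \<open>Either both ends of the second chord lie inside the arc from \<alpha> to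
    \<beta>, or, in each of the other three cases of \<open>sep\<close>, both lie outside
    it.\<close>
  proof (cases "\<alpha> < \<gamma> \<and> \<delta> < \<beta>")
    case True
    then have "convex hull {cis \<gamma>, cis \<delta>} \<subseteq> {z. u \<bullet> z > r}"
      using assms
      by (intro convex_hull_pair_subset convex_halfspace_gt)
         (auto simp: u r_def intro!: cos_less_cos_inside_arc)
    with e show ?thesis
      by fastforce
  next
    case False
    then have "convex hull {cis \<gamma>, cis \<delta>} \<subseteq> {z. u \<bullet> z < r}"
      using assms
      by (intro convex_hull_pair_subset convex_halfspace_lt)
         (auto simp: u r_def intro!: cos_less_cos_outside_arc)
    with e show ?thesis
      by fastforce
  qed
qed

section \<open>From angles to indices in the cyclic order\<close>

lemma position_nth:
  assumes "distinct \<omega>" "i < length \<omega>"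
  shows "position \<omega> (\<omega> ! i) = cis (2 * pi * real i / real (length \<omega>))"
proof -
  have "(THE k. k < length \<omega> \<and> \<omega> ! k = \<omega> ! i) = i"
    using assms by (auto simp: nth_eq_iff_index_eq)
  then show ?thesis
    by (simp add: position_def)
qed

text \<open>For \<open>i < j\<close> and \<open>k < l\<close>, this says that the four indices are
  distinct and the two pairs do not interleave. One condition thus excludes both a crossing and a
  common endpoint.\<close>

definition separated :: "nat \<Rightarrow> nat \<Rightarrow> nat \<Rightarrow> nat \<Rightarrow> bool" where
  "separated i j k l \<longleftrightarrow> i < k \<and> l < j \<or> j < k \<or> l < i \<or> k < i \<and> j < l"

lemma not_crosses_if_separated:
  assumes "distinct \<omega>" "i < j" "j < length \<omega>" "k < l" "l < length \<omega>" "separated i j k l"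
  shows "\<not> crosses \<omega> {\<omega> ! i, \<omega> ! j} {\<omega> ! k, \<omega> ! l}"
proof -
  define t where "t k = 2 * pi * real k / real (length \<omega>)" for k
  have mono: "t a < t b \<longleftrightarrow> a < b" for a b
    using assms by (auto simp: t_def divide_less_cancel)
  have nonneg: "0 \<le> t a" for a
    by (simp add: t_def)
  have bound: "t a < 2 * pi" if "a < length \<omega>" for a
  proof -
    have "real a / real (length \<omega>) < 1"
      using that by (cases "length \<omega> = 0") auto
    then have "2 * pi * (real a / real (length \<omega>)) < 2 * pi * 1"
      by (intro mult_strict_left_mono) auto
    then show ?thesis
      by (simp add: t_def)
  qed
  have "convex hull {cis (t i), cis (t j)} \<inter> convex hull {cis (t k), cis (t l)} = {}"
    using assms by (intro chords_disjoint) (auto simp: mono nonneg bound separated_def)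
  then show ?thesis
    using assms by (simp add: crosses_def chord_def position_nth t_def)
qed

section \<open>Counting edges by pages\<close>

lemma card_matching_le:
  assumes "finite V" "\<And>e. e \<in> M \<Longrightarrow> e \<subseteq> V \<and> card e = 2" "pairwise disjnt M"
  shows "card M \<le> card V div 2"
proof -
  have "card (\<Union>M) = sum card M"
    using assms by (intro card_Union_disjoint) (auto intro: finite_subset)
  also have "\<dots> = 2 * card M"
    using assms(2) by (simp add: sum.cong)
  finally have "2 * card M \<le> card V"
    using card_mono[of V "\<Union>M"] assms(1,2) by fastforce
  then show ?thesis
    by simp
qed

text \<open>Each page is a matching, so \<open>card_matching_le\<close> bounds it; the pages
  together cover all edges.\<close>

lemma card_edges_le_num_pages:
  assumes "matching_book_embedding G \<omega> c"
  shows "card (edges G) \<le> num_pages G c * (card (vertices G) div 2)"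
proof -
  let ?page = "\<lambda>k. {e \<in> edges G. c e = k}"
  have finV: "finite (vertices G)" and E: "\<forall>e\<in>edges G. e \<subseteq> vertices G \<and> card e = 2"
    using assms by (auto simp: matching_book_embedding_def simple_graph_def)
  have "edges G \<subseteq> Pow (vertices G)"
    using E by blast
  then have finE: "finite (edges G)"
    by (rule finite_subset) (simp add: finV)
  have "card (edges G) = card (\<Union>k\<in>c ` edges G. ?page k)"
    by (rule arg_cong[of _ _ card]) auto
  also have "\<dots> \<le> (\<Sum>k\<in>c ` edges G. card (?page k))"
    using finE by (intro card_UN_le) simp
  also have "\<dots> \<le> (\<Sum>k\<in>c ` edges G. card (vertices G) div 2)"
  proof (intro sum_mono card_matching_le[OF finV])
    show "pairwise disjnt (?page k)" for k
      using assms unfolding matching_book_embedding_def pairwise_def disjnt_def by blast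
  qed (use E in blast)
  also have "\<dots> = num_pages G c * (card (vertices G) div 2)"
    by (simp add: num_pages_def)
  finally show ?thesis .
qed

section \<open>The circulant graph\<close>

text \<open>Reduction to the representatives 1, ..., n, where \<open>mod\<close> would give 0 in
  place of \<open>n\<close>. One subtraction is enough for arguments up to
  \<open>2 * n\<close>.\<close>

definition wrap :: "nat \<Rightarrow> nat \<Rightarrow> nat" where
  "wrap n x = (if x \<le> n then x else x - n)"

lemma cong_iff_eq_wrap:
  assumes "k \<in> {1..n}" "x \<in> {1..2 * n}"
  shows "[k = x] (mod n) \<longleftrightarrow> k = wrap n x"
proof
  assume "[k = x] (mod n)"
  then have "int n dvd int x - int k"
    by (metis cong_iff_dvd_diff cong_int_iff cong_sym)
  then obtain q where q: "int x - int k = int n * q"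
    by (elim dvdE)
  \<comment> \<open>The ranges of \<open>x\<close> and \<open>k\<close> leave only the quotients 0
    and 1, which are the two branches of \<open>wrap\<close>.\<close>
  have "- int n < int n * q" "int n * q < int n * 2"
    using assms unfolding q[symmetric] by auto
  then have "- 1 < q" "q < 2"
    using assms mult_less_cancel_left_pos[of "int n" q 2]
      mult_less_cancel_left_pos[of "int n" "-1" q] by auto
  then consider "q = 0" | "q = 1"
    by linarith
  then show "k = wrap n x"
    using q assms by cases (auto simp: wrap_def)
next
  assume "k = wrap n x"
  then show "[k = x] (mod n)"
    by (auto simp: wrap_def cong_def le_mod_geq)
qed

lemma circulant_edges:
  assumes "S \<subseteq> {1..n}"
  shows "edges (circulant n S) = (\<lambda>(v, i). {v, wrap n (v + i)}) ` ({1..n} \<times> S)"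
proof -
  have "k \<in> {1..n} \<and> [k = j + i] (mod n) \<longleftrightarrow> k = wrap n (j + i)"
    if "j \<in> {1..n}" "i \<in> S" for j k i
  proof -
    have "i \<in> {1..n}"
      using that assms by blast
    then have "j + i \<in> {1..2 * n}" "wrap n (j + i) \<in> {1..n}"
      using that(1) by (auto simp: wrap_def)
    then show ?thesis
      using cong_iff_eq_wrap[of k n "j + i"] by auto
  qed
  then show ?thesis
    unfolding circulant_def by (auto simp: image_iff) (metis atLeastAtMost_iff One_nat_def)+
qed

text \<open>Traversing one edge in opposite directions would make \<open>i + j\<close> a multiple of
  \<open>n\<close>, but \<open>0 < i + j < n\<close>. Hence each edge has a unique start and step,
  which makes edges countable.\<close>

lemma wrap_doubleton_inj:
  assumes "{v, wrap n (v + i)} = {w, wrap n (w + j)}"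
    and "v \<in> {1..n}" "w \<in> {1..n}" "0 < i" "2 * i < n" "0 < j" "2 * j < n"
  shows "v = w \<and> i = j"
proof -
  consider "v = w" "wrap n (v + i) = wrap n (w + j)" | "v = wrap n (w + j)" "wrap n (v + i) = w"
    using assms(1) by (auto simp: doubleton_eq_iff)
  then show ?thesis
    using assms(2-) by cases (auto simp: wrap_def split: if_splits)
qed

lemma card_circulant_edges:
  assumes "n \<ge> 7"
  shows "card (edges (circulant n {1, 2, 3})) = 3 * n"
proof -
  let ?S = "{1, 2, 3} :: nat set"
  have S: "0 < i \<and> 2 * i < n" if "i \<in> ?S" for i
    using that assms by auto
  have "inj_on (\<lambda>(v, i). {v, wrap n (v + i)}) ({1..n} \<times> ?S)"
  proof (rule inj_onI)
    fix x y
    assume "x \<in> {1..n} \<times> ?S" "y \<in> {1..n} \<times> ?S"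
      and "(\<lambda>(v, i). {v, wrap n (v + i)}) x = (\<lambda>(v, i). {v, wrap n (v + i)}) y"
    then show "x = y"
      using wrap_doubleton_inj[of "fst x" n "snd x" "fst y" "snd y"] S
      by (simp add: case_prod_beta mem_Times_iff prod_eq_iff)
  qed
  moreover have "?S \<subseteq> {1..n}"
    using assms by auto
  ultimately show ?thesis
    by (simp add: circulant_edges card_image card_cartesian_product)
qed

lemma in_circulant_edges_iff:
  assumes "S \<subseteq> {1..n}"
  shows "e \<in> edges (circulant n S) \<longleftrightarrow> (\<exists>v\<in>{1..n}. \<exists>i\<in>S. e = {v, wrap n (v + i)})"
  unfolding circulant_edges[OF assms] by auto

text \<open>A step of \<open>i\<close> backwards is a step of \<open>n - i\<close> forwards, so the
  edges at \<open>v\<close> are indexed by six forward steps, distinct since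
  \<open>n \<ge> 7\<close>.\<close>

lemma degree_circulant:
  assumes "n \<ge> 7" "v \<in> {1..n}"
  shows "degree (circulant n {1, 2, 3}) v = 6"
proof -
  let ?D = "{1, 2, 3, n - 1, n - 2, n - 3}"
  have S: "{1, 2, 3} \<subseteq> {1..n}"
    using assms(1) by auto
  have wrap_back: "wrap n (wrap n (v + i) + (n - i)) = v" "wrap n (v + i) \<in> {1..n}"
    if "v \<in> {1..n}" "1 \<le> i" "i \<le> n" for v i
    using that by (auto simp: wrap_def)
  have "{e \<in> edges (circulant n {1, 2, 3}). v \<in> e} = (\<lambda>d. {v, wrap n (v + d)}) ` ?D"
    (is "?L = ?R")
  proof
    show "?L \<subseteq> ?R"
    proof
      fix e assume "e \<in> ?L"
      then obtain w i where wi: "w \<in> {1..n}" "i \<in> {1, 2, 3}" "e = {w, wrap n (w + i)}" "v \<in> e"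
        unfolding in_circulant_edges_iff[OF S] mem_Collect_eq by blast
      show "e \<in> ?R"
      proof (cases "v = w")
        case True
        then show ?thesis
          using wi by blast
      next
        case False
        then have v: "v = wrap n (w + i)"
          using wi by auto
        have i: "1 \<le> i" "i \<le> n"
          using wi(2) assms(1) by auto
        have "e = {v, wrap n (v + (n - i))}"
          unfolding wi(3) v wrap_back(1)[OF wi(1) i] by (rule insert_commute)
        moreover have "n - i \<in> ?D"
          using wi by blast
        ultimately show ?thesis
          by blast
      qed
    qed
    show "?R \<subseteq> ?L"
    proof
      fix e assume "e \<in> ?R"
      then obtain d where d: "d \<in> ?D" "e = {v, wrap n (v + d)}"
        by blast
      have "\<exists>w\<in>{1..n}. \<exists>i\<in>{1, 2, 3}. e = {w, wrap n (w + i)}"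
      proof (cases "d \<in> {1, 2, 3}")
        case True
        then show ?thesis
          using assms d by blast
      next
        case False
        then have i: "n - d \<in> {1, 2, 3}" "1 \<le> d" "d \<le> n"
          using d(1) assms(1) by auto
        have "e = {wrap n (v + d), wrap n (wrap n (v + d) + (n - d))}"
          unfolding wrap_back(1)[OF assms(2) i(2,3)] d(2) by (rule insert_commute)
        then show ?thesis
          using i wrap_back(2)[of v d] assms(2) by blast
      qed
      then show "e \<in> ?L"
        unfolding mem_Collect_eq in_circulant_edges_iff[OF S] using d(2) by blast
    qed
  qed
  moreover have "inj_on (\<lambda>d. {v, wrap n (v + d)}) ?D"
  proof (rule inj_on_subset)
    show "?D \<subseteq> {..<n}"
      using assms(1) by auto
    show "inj_on (\<lambda>d. {v, wrap n (v + d)}) {..<n}"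
      using assms(2) by (auto simp: inj_on_def doubleton_eq_iff wrap_def split: if_splits)
  qed
  moreover have "card ?D = 6"
  proof -
    obtain k where "n = 7 + k"
      using assms(1) by (rule less_eqE)
    then show ?thesis
      by simp
  qed
  ultimately show ?thesis
    by (simp only: degree_def card_image)
qed

lemma max_degree_circulant:
  assumes "n \<ge> 7"
  shows "max_degree (circulant n {1, 2, 3}) = 6"
proof -
  have "(SUP v\<in>{1..n}. degree (circulant n {1, 2, 3}) v) = (SUP v\<in>{1..n}. 6)"
    using degree_circulant[OF assms] by (intro SUP_cong) auto
  then show ?thesis
    using assms by (simp add: max_degree_def circulant_def)
qed

text \<open>Six pages hold at most \<open>6 * (n div 2) = 3 * n - 3\<close> edges. As the order is
  arbitrary, this both refutes dispersability and shows that the constructed embedding uses exactly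
  seven pages.\<close>

lemma circulant_num_pages_ge:
  assumes "n \<ge> 7" "odd n" "matching_book_embedding (circulant n {1, 2, 3}) \<omega> c"
  shows "num_pages (circulant n {1, 2, 3}) c \<ge> 7"
proof (rule ccontr)
  assume "\<not> ?thesis"
  then have "num_pages (circulant n {1, 2, 3}) c * (n div 2) \<le> 6 * (n div 2)"
    by (intro mult_right_mono) auto
  moreover have "3 * n \<le> num_pages (circulant n {1, 2, 3}) c * (n div 2)"
    using card_edges_le_num_pages[OF assms(3)] card_circulant_edges[OF assms(1)]
    by (simp add: circulant_def)
  moreover have "6 * (n div 2) < 3 * n"
    using assms(2) by (elim oddE) simp
  ultimately show False
    by linarith
qed

section \<open>Seven pages\<close>

lemma filter_odd_upt: "filter odd [1..<Suc (2 * m + 1)] = map (\<lambda>i. 2 * i + 1) [0..<Suc m]"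
  by (induction m) auto

lemma filter_even_upt: "filter even [1..<Suc (2 * m + 1)] = map (\<lambda>i. 2 * i + 2) [0..<m]"
  by (induction m) auto

lemma length_odd_even_order: "length (odd_even_order (2 * m + 1)) = 2 * m + 1"
  unfolding odd_even_order_def filter_odd_upt filter_even_upt by simp

lemma nth_odd_even_order:
  assumes "i \<le> 2 * m"
  shows "odd_even_order (2 * m + 1) ! i = (if i \<le> m then 2 * i + 1 else 2 * (2 * m + 1 - i))"
  using assms unfolding odd_even_order_def filter_odd_upt filter_even_upt
  by (auto simp: nth_append rev_nth simp del: upt_Suc)

text \<open>With \<open>n = 2 m + 1\<close>, the odd vertex \<open>2 p + 1\<close> has index \<open>p\<close> and the even vertex \<open>2 q\<close> has
  index \<open>2 m + 1 - q\<close> in the order; \<open>page m k i j\<close> puts the edge with these indices on page \<open>k\<close>.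
  Pages 0 to 3 hold the edges of index sum \<open>2 m\<close>, \<open>2 m + 1\<close>, \<open>2 m - 1\<close>, \<open>2 m + 2\<close>, which are parallel
  chords of the regular polygon. The remaining edges are the sides of the polygon, along which
  pages 4 and 6 alternate, and the long chords coming from the wrap-around.\<close>

inductive page :: "nat \<Rightarrow> nat \<Rightarrow> nat \<Rightarrow> nat \<Rightarrow> bool" for m :: nat where
  p0: "p < m \<Longrightarrow> page m 0 p (2 * m - p)"
| p1: "1 \<le> p \<Longrightarrow> p \<le> m \<Longrightarrow> page m 1 p (2 * m + 1 - p)"
| p2: "p < m \<Longrightarrow> page m 2 p (2 * m - 1 - p)"
| p3: "2 \<le> p \<Longrightarrow> p \<le> m \<Longrightarrow> page m 3 p (2 * m + 2 - p)"
| p3a: "page m 3 0 1"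
| p4: "page m 4 0 m"
| p4a: "page m 4 (m + 1) (2 * m)"
| p4b: "odd p \<Longrightarrow> p + 2 \<le> m \<Longrightarrow> page m 4 p (p + 1)"
| p4c: "even p \<Longrightarrow> m + 2 \<le> p \<Longrightarrow> p + 2 \<le> 2 * m \<Longrightarrow> page m 4 p (p + 1)"
| p5: "page m 5 0 (m - 1)"
| p5a: "page m 5 m (2 * m)"
| p5b: "page m 5 (m + 1) (m + 2)"
| p6: "page m 6 1 m"
| p6a: "page m 6 0 (m + 1)"
| p6b: "even p \<Longrightarrow> 2 \<le> p \<Longrightarrow> p + 2 \<le> m \<Longrightarrow> page m 6 p (p + 1)"
| p6c: "odd p \<Longrightarrow> m + 2 \<le> p \<Longrightarrow> p < 2 * m \<Longrightarrow> page m 6 p (p + 1)"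

lemma page_range:
  assumes "page m k i j" "m \<ge> 3"
  shows "i < j" "j \<le> 2 * m" "k < 7"
  using assms by (auto elim!: page.cases)

text \<open>Chords of equal index sum are nested, and sides whose first indices have equal parity
  are disjoint. On pages 4 to 6 the two long chords are nested or lie apart, and the sides fit
  inside or beside them; for instance \<open>m + 2 < 2 * m\<close> places the side of page 5 inside
  the chord from \<open>m\<close> to \<open>2 * m\<close>.\<close>

lemma page_separated:
  assumes "page m k i j" "page m k i' j'" "m \<ge> 3"
  shows "i = i' \<and> j = j' \<or> separated i j i' j'"
  using assms(3)
  by - (rule page.cases[OF assms(1)]; rule page.cases[OF assms(2)]; simp add: separated_def; presburger)

text \<open>Without wrap-around, steps 1 and 3 join an odd to an even vertex and give the four
  constant index sums, while step 2 gives sides. The six wrapping edges are the long chords, two on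
  each of pages 4, 5 and 6.\<close>

lemma circulant_edge_on_page:
  fixes m v i :: nat
  defines "L \<equiv> \<lambda>j. odd_even_order (2 * m + 1) ! j"
  assumes m: "m \<ge> 3" and v: "v \<in> {1..2 * m + 1}" and i: "i \<in> {1, 2, 3}"
  shows "\<exists>k a b. page m k a b \<and> {v, wrap (2 * m + 1) (v + i)} = {L a, L b}"
proof -
  have L: "L j = (if j \<le> m then 2 * j + 1 else 2 * (2 * m + 1 - j))" if "j \<le> 2 * m" for j
    unfolding L_def using that by (rule nth_odd_even_order)
  \<comment> \<open>\<open>page\<close> lists the smaller index first: \<open>fwd\<close> serves
    edges whose start \<open>v\<close> has the smaller index, \<open>bwd\<close> the others.\<close>
  have fwd: ?thesis
    if "page m k a b" "L a = v" "L b = wrap (2 * m + 1) (v + i)" for k a b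
    using that by (intro exI[of _ k] exI[of _ a] exI[of _ b]) simp
  have bwd: ?thesis
    if "page m k a b" "L b = v" "L a = wrap (2 * m + 1) (v + i)" for k a b
    using that by (intro exI[of _ k] exI[of _ a] exI[of _ b]) (simp add: insert_commute)
  show ?thesis
  proof (cases "odd v")
    case True
    then obtain p where vp: "v = 2 * p + 1"
      by (elim oddE)
    with v have p: "p \<le> m"
      by simp
    consider "i = 1" | "i = 2" | "i = 3"
      using i by blast
    then show ?thesis
    proof cases
      case 1
      consider "p < m" | "p = m"
        using p by linarith
      then show ?thesis
      proof cases
        case 1
        show ?thesis
          by (rule fwd[OF p0[OF 1]]) (use 1 \<open>i = 1\<close> vp in \<open>auto simp: L wrap_def\<close>)
      next
        case 2
        show ?thesis
          by (rule bwd[OF p4]) (use 2 \<open>i = 1\<close> vp in \<open>auto simp: L wrap_def\<close>)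
      qed
    next
      case 2
      \<comment> \<open>The sides at \<open>p = 0\<close> and \<open>p = m - 1\<close> each have an
        endpoint on long chords of both page 4 and page 6, so they go to pages 3 and 2. At
        \<open>p = m\<close> the edge wraps; the other sides alternate by parity.\<close>
      have "p = 0 \<or> p = m - 1 \<or> odd p \<and> p + 2 \<le> m \<or> even p \<and> 2 \<le> p \<and> p + 2 \<le> m \<or> p = m"
        using p by presburger
      then consider "p = 0" | "p = m - 1" | "odd p" "p + 2 \<le> m"
        | "even p" "2 \<le> p" "p + 2 \<le> m" | "p = m"
        by blast
      then show ?thesis
      proof cases
        case 1
        show ?thesis
          by (rule fwd[OF p3a]) (use 1 \<open>i = 2\<close> vp m in \<open>auto simp: L wrap_def\<close>)
      next
        case 2
        then have "p < m"
          using m by simp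
        then show ?thesis
          by (rule fwd[OF p2]) (use 2 \<open>i = 2\<close> vp m in \<open>auto simp: L wrap_def\<close>)
      next
        case 3
        show ?thesis
          by (rule fwd[OF p4b[OF 3]]) (use 3 \<open>i = 2\<close> vp m in \<open>auto simp: L wrap_def\<close>)
      next
        case 4
        show ?thesis
          by (rule fwd[OF p6b[OF 4]]) (use 4 \<open>i = 2\<close> vp m in \<open>auto simp: L wrap_def\<close>)
      next
        case 5
        show ?thesis
          by (rule fwd[OF p5a]) (use 5 \<open>i = 2\<close> vp m in \<open>auto simp: L wrap_def\<close>)
      qed
    next
      case 3
      consider "p + 2 \<le> m" | "p = m - 1" | "p = m"
        using p by linarith
      then show ?thesis
      proof cases
        case 1
        then have "p < m"
          by simp
        then show ?thesis
          by (rule fwd[OF p2]) (use 1 \<open>i = 3\<close> vp m in \<open>auto simp: L wrap_def\<close>)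
      next
        case 2
        show ?thesis
          by (rule bwd[OF p5]) (use 2 \<open>i = 3\<close> vp m in \<open>auto simp: L wrap_def\<close>)
      next
        case 3
        show ?thesis
          by (rule bwd[OF p6]) (use 3 \<open>i = 3\<close> vp m in \<open>auto simp: L wrap_def\<close>)
      qed
    qed
  next
    case False
    then obtain q where vq: "v = 2 * q"
      by (auto elim: evenE)
    with v have q: "1 \<le> q" "q \<le> m"
      by auto
    consider "i = 1" | "i = 2" | "i = 3"
      using i by blast
    then show ?thesis
    proof cases
      case 1
      show ?thesis
        by (rule bwd[OF p1[OF q]]) (use q 1 vq in \<open>auto simp: L wrap_def\<close>)
    next
      case 2
      \<comment> \<open>The side has smaller index \<open>2 * m - q\<close>, of the same parity as
        \<open>q\<close>. For \<open>q = m - 1\<close> its end \<open>m + 1\<close> is taken on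
        pages 4 and 6, hence page 5; for \<open>q = m\<close> the edge wraps.\<close>
      have "q = m \<or> q = m - 1 \<or> even q \<and> q + 2 \<le> m \<or> odd q \<and> q + 2 \<le> m"
        using q by presburger
      then consider "q = m" | "q = m - 1" | "even q" "q + 2 \<le> m" | "odd q" "q + 2 \<le> m"
        by blast
      then show ?thesis
      proof cases
        case 1
        show ?thesis
          by (rule bwd[OF p6a]) (use 1 \<open>i = 2\<close> vq m in \<open>auto simp: L wrap_def\<close>)
      next
        case 2
        show ?thesis
          by (rule bwd[OF p5b]) (use 2 \<open>i = 2\<close> vq m in \<open>auto simp: L wrap_def\<close>)
      next
        case 3
        then have "even (2 * m - q)" "m + 2 \<le> 2 * m - q" "2 * m - q + 2 \<le> 2 * m"
          using q by presburger+
        then show ?thesis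
          by (rule bwd[OF p4c]) (use 3 q \<open>i = 2\<close> vq m in \<open>auto simp: L wrap_def\<close>)
      next
        case 4
        then have "odd (2 * m - q)" "m + 2 \<le> 2 * m - q" "2 * m - q < 2 * m"
          using q by presburger+
        then show ?thesis
          by (rule bwd[OF p6c]) (use 4 q \<open>i = 2\<close> vq m in \<open>auto simp: L wrap_def\<close>)
      qed
    next
      case 3
      consider "q < m" | "q = m"
        using q by linarith
      then show ?thesis
      proof cases
        case 1
        then have "2 \<le> q + 1" "q + 1 \<le> m"
          using q by auto
        then show ?thesis
          by (rule bwd[OF p3]) (use 1 q \<open>i = 3\<close> vq m in \<open>auto simp: L wrap_def\<close>)
      next
        case 2
        show ?thesis
          by (rule fwd[OF p4a]) (use 2 \<open>i = 3\<close> vq m in \<open>auto simp: L wrap_def\<close>)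
      qed
    qed
  qed
qed

lemma circulant_seven_pages:
  assumes "n \<ge> 7" "odd n"
  obtains c where "matching_book_embedding (circulant n {1, 2, 3}) (odd_even_order n) c"
    and "num_pages (circulant n {1, 2, 3}) c \<le> 7"
proof -
  let ?G = "circulant n {1, 2, 3}" and ?\<omega> = "odd_even_order n"
  obtain m where n: "n = 2 * m + 1"
    using assms(2) by (elim oddE)
  with assms(1) have m: "m \<ge> 3"
    by simp
  have S: "{1, 2, 3} \<subseteq> {1..n}"
    using assms(1) by auto
  have dist: "distinct ?\<omega>"
    using cyclic_order_odd_even_order by (auto simp: cyclic_order_def)
  have len: "length ?\<omega> = 2 * m + 1"
    unfolding n by (rule length_odd_even_order)
  \<comment> \<open>Any page carrying the edge will do, since \<open>page_separated\<close> applies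
    to any two index pairs on one page.\<close>
  define c where "c e = (SOME k. \<exists>a b. page m k a b \<and> e = {?\<omega> ! a, ?\<omega> ! b})" for e
  have c: "\<exists>a b. page m (c e) a b \<and> e = {?\<omega> ! a, ?\<omega> ! b}" if "e \<in> edges ?G" for e
  proof -
    from that obtain v i where "v \<in> {1..n}" "i \<in> {1, 2, 3}" "e = {v, wrap n (v + i)}"
      unfolding in_circulant_edges_iff[OF S] by blast
    then have "\<exists>k a b. page m k a b \<and> e = {?\<omega> ! a, ?\<omega> ! b}"
      using circulant_edge_on_page[OF m, of v i] n by simp
    then show ?thesis
      unfolding c_def by (rule someI_ex)
  qed
  show thesis
  proof (rule that[of c])
    have "\<not> crosses ?\<omega> e f \<and> e \<inter> f = {}"
      if ef: "e \<in> edges ?G" "f \<in> edges ?G" "e \<noteq> f" "c e = c f" for e f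
    proof -
      obtain a b where ab: "page m (c e) a b" "e = {?\<omega> ! a, ?\<omega> ! b}"
        using c ef(1) by blast
      obtain a' b' where ab': "page m (c e) a' b'" "f = {?\<omega> ! a', ?\<omega> ! b'}"
        using c[OF ef(2)] ef(4) by auto
      have sep: "separated a b a' b'"
        using page_separated[OF ab(1) ab'(1) m] ab(2) ab'(2) ef(3) by blast
      have lt: "a < b" "b < length ?\<omega>" "a' < b'" "b' < length ?\<omega>"
        using page_range[OF ab(1) m] page_range[OF ab'(1) m] by (auto simp: len)
      have "\<not> crosses ?\<omega> e f"
        using not_crosses_if_separated[OF dist lt sep] ab(2) ab'(2) by simp
      moreover have "e \<inter> f = {}"
        using sep lt dist by (auto simp: ab(2) ab'(2) separated_def nth_eq_iff_index_eq)
      ultimately show ?thesis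
        by blast
    qed
    moreover have "simple_graph ?G"
      using assms(1) by (intro simple_graph_circulant) auto
    moreover have "cyclic_order ?\<omega> (vertices ?G)"
      using cyclic_order_odd_even_order by (simp add: circulant_def)
    ultimately show "matching_book_embedding ?G ?\<omega> c"
      by (simp add: matching_book_embedding_def)
    have "c ` edges ?G \<subseteq> {..<7}"
      using c page_range(3)[OF _ m] by blast
    then have "card (c ` edges ?G) \<le> card {..<7::nat}"
      by (intro card_mono) auto
    then show "num_pages ?G c \<le> 7"
      by (simp add: num_pages_def)
  qed
qed

theorem theorem6:
  fixes n :: nat
  assumes "n \<ge> 7" and "odd n"
  shows "nearly_dispersable_wrt (circulant n {1, 2, 3}) (odd_even_order n)"
proof -
  let ?G = "circulant n {1, 2, 3}"
  obtain c where c: "matching_book_embedding ?G (odd_even_order n) c" "num_pages ?G c \<le> 7"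
    using circulant_seven_pages[OF assms] .
  have "num_pages ?G c = 1 + max_degree ?G"
    using circulant_num_pages_ge[OF assms c(1)] c(2) max_degree_circulant[OF assms(1)] by simp
  moreover have "\<not> dispersable ?G"
    using circulant_num_pages_ge[OF assms] max_degree_circulant[OF assms(1)]
    by (fastforce simp: dispersable_def)
  ultimately show ?thesis
    using c(1) by (auto simp: nearly_dispersable_wrt_def)
qed

end
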